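(* Let $n\ge 2$ and $G_n=C_{2^n}\times C_{2^n}$ with orbit tree $T_n$. For a node $N$ at level $n$ of $T_n$, let $P^+$ be the set of nodes on the path from $N$ to the root (including both $N$ and the root), let $P^-$ be the set of nodes $X$ of $T_n$ that are children of some node of $P^+$ but are not in $P^+$, and define $\chi_N$ on nodes $M$ of $T_n$ by $\chi_N(M)=|M|$ if $M\in P^+$, $\chi_N(M)=-|M|$ if $M\in P^-$, and $\chi_N(M)=0$ otherwise. Then for every character $\chi\in G_n^*$ of order $2^n$ (the highest possible order) there exists a unique node $N$ at level $n$ of $T_n$ such that $\chi(M)=\chi_N(M)$ for every node $M$ of $T_n$, where $\chi(M)=\sum_{g\in M}\chi(g)$.
   Context: $C_m=\{x/m: x\in\{0,\dots,m-1\}\}$ under addition mod $1$, and $G_n=C_{2^n}\times C_{2^n}$, with dual group $G_n^*$ of complex characters. The multiplier group $U(2^n)=\{u: u \text{ odd}, 1\le u\le 2^n\}$ acts on $G_n$ by $g\mapsto u\cdot g$. The orbit tree $T_n$ is the rooted tree whose nodes are the orbits of $G_n$ under this action: the root is $\{(0,0)\}$, the nodes at level $i$ are the orbits consisting of elements of order $2^i$ ($0\le i\le n$), and the parent of a node $M$ at level $i+1$ is the orbit containing $2x$ for any $x\in M$; the children of a node are the nodes whose parent it is. *)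

theory Defs
  imports Complex_Main "HOL-Algebra.Algebra"
begin

definition cyc :: "nat \<Rightarrow> rat monoid" where
  "cyc m = \<lparr>carrier = {of_nat x / of_nat m | x. x < m},
            monoid.mult = (\<lambda>a b. frac (a + b)), one = 0\<rparr>"

definition GG :: "nat \<Rightarrow> (rat \<times> rat) monoid" where
  "GG n = cyc (2 ^ n) \<times>\<times> cyc (2 ^ n)"

definition Cstar :: "complex monoid" where
  "Cstar = \<lparr>carrier = UNIV - {0}, monoid.mult = (*), one = 1\<rparr>"

text \<open>
  Characters are taken extensional, so that equality in the dual group is
  equality on the carrier of the group.
\<close>

definition dual_group :: "('a, 'b) monoid_scheme \<Rightarrow> ('a \<Rightarrow> complex) monoid" where
  "dual_group G =
     \<lparr>carrier = hom G Cstar \<inter> extensional (carrier G),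
      monoid.mult = (\<lambda>\<chi> \<psi>. \<lambda>g\<in>carrier G. \<chi> g * \<psi> g),
      one = (\<lambda>g\<in>carrier G. 1)\<rparr>"

text \<open>
  The odd residues modulo \<open>2^n\<close>; closed under multiplication for \<open>n \<ge> 1\<close> only
  (for \<open>n = 0\<close> the product \<open>1 * 1 mod 1\<close> is \<open>0\<close>).
\<close>

definition mult_group :: "nat \<Rightarrow> nat monoid" where
  "mult_group n =
     \<lparr>carrier = {u. odd u \<and> 1 \<le> u \<and> u \<le> 2 ^ n},
      monoid.mult = (\<lambda>u v. u * v mod 2 ^ n), one = 1\<rparr>"

definition mult_action :: "nat \<Rightarrow> nat \<Rightarrow> rat \<times> rat \<Rightarrow> rat \<times> rat" where
  "mult_action n u = (\<lambda>g\<in>carrier (GG n). g [^]\<^bsub>GG n\<^esub> u)"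

definition nodes :: "nat \<Rightarrow> (rat \<times> rat) set set" where
  "nodes n = orbits (mult_group n) (carrier (GG n)) (mult_action n)"

definition root_node :: "(rat \<times> rat) set" where
  "root_node = {(0, 0)}"

definition level_nodes :: "nat \<Rightarrow> nat \<Rightarrow> (rat \<times> rat) set set" where
  "level_nodes n i = {M \<in> nodes n. \<forall>x\<in>M. group.ord (GG n) x = 2 ^ i}"

text \<open>
  \<open>(M, N) \<in> parent_rel n\<close> says that \<open>N\<close> is the parent of \<open>M\<close>. The group is written
  multiplicatively, so \<open>2x\<close> appears as \<open>x \<otimes> x\<close>.
\<close>

definition parent_rel :: "nat \<Rightarrow> ((rat \<times> rat) set \<times> (rat \<times> rat) set) set" where
  "parent_rel n = {(M, N). N \<in> nodes n \<and>
     (\<exists>i. M \<in> level_nodes n (Suc i)) \<and> (\<forall>x\<in>M. x \<otimes>\<^bsub>GG n\<^esub> x \<in> N)}"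

definition children :: "nat \<Rightarrow> (rat \<times> rat) set \<Rightarrow> (rat \<times> rat) set set" where
  "children n N = {M. (M, N) \<in> parent_rel n}"

definition P_plus :: "nat \<Rightarrow> (rat \<times> rat) set \<Rightarrow> (rat \<times> rat) set set" where
  "P_plus n N = {Y. (N, Y) \<in> (parent_rel n)\<^sup>* \<and> (Y, root_node) \<in> (parent_rel n)\<^sup>*}"

definition P_minus :: "nat \<Rightarrow> (rat \<times> rat) set \<Rightarrow> (rat \<times> rat) set set" where
  "P_minus n N = (\<Union>Y\<in>P_plus n N. children n Y) - P_plus n N"

definition chi_node :: "nat \<Rightarrow> (rat \<times> rat) set \<Rightarrow> (rat \<times> rat) set \<Rightarrow> complex" where
  "chi_node n N M =
     (if M \<in> P_plus n N then of_nat (card M)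
      else if M \<in> P_minus n N then - of_nat (card M)
      else 0)"

lemma Cstar_comm_group: "comm_group Cstar"
proof (rule comm_groupI)
  fix x
  assume "x \<in> carrier Cstar"
  then show "\<exists>y\<in>carrier Cstar. y \<otimes>\<^bsub>Cstar\<^esub> x = \<one>\<^bsub>Cstar\<^esub>"
    by (intro bexI[of _ "inverse x"]) (auto simp: Cstar_def)
qed (auto simp: Cstar_def)

lemma cyc_carrier_iff:
  assumes "m > 0"
  shows "a \<in> carrier (cyc m) \<longleftrightarrow> 0 \<le> a \<and> a < 1 \<and> a * of_nat m \<in> \<int>"
proof
  assume "a \<in> carrier (cyc m)"
  then obtain x where x: "a = of_nat x / of_nat m" "x < m"
    by (auto simp: cyc_def)
  then show "0 \<le> a \<and> a < 1 \<and> a * of_nat m \<in> \<int>"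
    using assms by simp
next
  assume a: "0 \<le> a \<and> a < 1 \<and> a * of_nat m \<in> \<int>"
  then obtain k where k: "a * of_nat m = of_int k"
    by (auto elim: Ints_cases)
  have "(of_int k :: rat) \<ge> 0"
    unfolding k[symmetric] using a by simp
  then have "k \<ge> 0" by simp
  have "(of_int k :: rat) < of_nat m"
    unfolding k[symmetric] using a assms by simp
  then have "k < int m"
    by (metis of_int_less_iff of_int_of_nat_eq)
  have "a = of_nat (nat k) / of_nat m"
    using k \<open>k \<ge> 0\<close> assms by (simp add: field_simps)
  then show "a \<in> carrier (cyc m)"
    using \<open>k < int m\<close> \<open>k \<ge> 0\<close> by (auto simp: cyc_def intro!: exI[of _ "nat k"])
qed

lemma cyc_frac_closed:
  assumes "m > 0" "a * of_nat m \<in> \<int>"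
  shows "frac a \<in> carrier (cyc m)"
proof -
  have "frac a * of_nat m \<in> \<int>"
    using assms by (auto simp: frac_def left_diff_distrib intro!: Ints_diff Ints_mult)
  then show ?thesis
    using assms by (simp add: cyc_carrier_iff frac_ge_0 frac_lt_1)
qed

lemma cyc_comm_group:
  assumes "m > 0"
  shows "comm_group (cyc m)"
proof (rule comm_groupI)
  fix x y z
  assume x: "x \<in> carrier (cyc m)" and y: "y \<in> carrier (cyc m)" and z: "z \<in> carrier (cyc m)"
  show "x \<otimes>\<^bsub>cyc m\<^esub> y \<in> carrier (cyc m)"
    using x y cyc_frac_closed[OF assms, of "x + y"]
    by (auto simp: cyc_carrier_iff[OF assms] distrib_right) (auto simp: cyc_def)
  have "frac (frac (x + y) + z) = frac (x + y + z)" "frac (x + frac (y + z)) = frac (x + (y + z))"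
    by (simp_all add: frac_def add.assoc[symmetric] diff_add_eq add_diff_eq)
  then show "(x \<otimes>\<^bsub>cyc m\<^esub> y) \<otimes>\<^bsub>cyc m\<^esub> z = x \<otimes>\<^bsub>cyc m\<^esub> (y \<otimes>\<^bsub>cyc m\<^esub> z)"
    by (simp add: cyc_def add.assoc)
next
  fix x
  assume x: "x \<in> carrier (cyc m)"
  then show "\<one>\<^bsub>cyc m\<^esub> \<otimes>\<^bsub>cyc m\<^esub> x = x"
    using assms by (simp add: cyc_carrier_iff) (simp add: cyc_def frac_eq)
  show "\<exists>y\<in>carrier (cyc m). y \<otimes>\<^bsub>cyc m\<^esub> x = \<one>\<^bsub>cyc m\<^esub>"
  proof
    show "frac (- x) \<in> carrier (cyc m)"
      using x assms by (intro cyc_frac_closed) (auto simp: cyc_carrier_iff)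
    show "frac (- x) \<otimes>\<^bsub>cyc m\<^esub> x = \<one>\<^bsub>cyc m\<^esub>"
      by (simp add: cyc_def frac_def)
  qed
qed (use assms in \<open>auto simp: cyc_def add.commute\<close>)

lemma GG_group: "group (GG n)"
  unfolding GG_def
  by (intro DirProd_group comm_group.axioms(2) cyc_comm_group) auto

lemma dual_group_comm_group:
  assumes "group G"
  shows "comm_group (dual_group G)"
proof -
  interpret group G by fact
  show ?thesis
  proof (rule comm_groupI)
    fix \<chi>
    assume \<chi>: "\<chi> \<in> carrier (dual_group G)"
    let ?i = "\<lambda>g\<in>carrier G. inverse (\<chi> g)"
    show "\<exists>\<psi>\<in>carrier (dual_group G). \<psi> \<otimes>\<^bsub>dual_group G\<^esub> \<chi> = \<one>\<^bsub>dual_group G\<^esub>"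
      using \<chi> by (intro bexI[of _ ?i])
        (auto simp: dual_group_def hom_def Cstar_def Pi_def fun_eq_iff)
  qed (auto simp: dual_group_def hom_def Cstar_def Pi_def fun_eq_iff extensional_def algebra_simps)
qed

end

theory Submission
  imports Defs "HOL-Number_Theory.Cong"
begin

text \<open>
  The orbit of \<open>x\<close> is the set of odd powers of \<open>x\<close>, so the sum of \<open>\<chi>\<close> over it is \<open>\<plusminus>\<close> its size
  if \<open>\<chi> x = \<plusminus>1\<close>, and it vanishes otherwise because multiplication by a suitable even power of \<open>x\<close>
  permutes the orbit and changes the sign of \<open>\<chi>\<close>. The kernel of a character of order \<open>2^n\<close> is
  cyclic of order \<open>2^n\<close>, and \<open>N\<close> is the set of its generators: the path from \<open>N\<close> to the root
  consists of the orbits inside the kernel, and an orbit outside the kernel hangs off this path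
  iff \<open>\<chi>\<close> is \<open>1\<close> on its square, that is, iff \<open>\<chi> = -1\<close> on it.
\<close>

definition odd_powers :: "('a, 'b) monoid_scheme \<Rightarrow> 'a \<Rightarrow> 'a set" where
  "odd_powers G x = {x [^]\<^bsub>G\<^esub> (u::nat) | u. odd u}"

section \<open>Characters on powers, and complex roots of unity of 2-power order\<close>

lemma hom_Cstar_nat_pow:
  assumes "monoid G" "\<chi> \<in> hom G Cstar" "x \<in> carrier G"
  shows "\<chi> (x [^]\<^bsub>G\<^esub> (k::nat)) = \<chi> x ^ k"
proof -
  interpret monoid G by fact
  have m: "\<chi> (a \<otimes>\<^bsub>G\<^esub> b) = \<chi> a * \<chi> b" "\<chi> a \<noteq> 0" if "a \<in> carrier G" "b \<in> carrier G" for a b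
    using assms(2) that by (auto simp: hom_def Cstar_def)
  have "\<chi> \<one>\<^bsub>G\<^esub> = 1"
    using m[of "\<one>\<^bsub>G\<^esub>" "\<one>\<^bsub>G\<^esub>"] by simp
  then show ?thesis
    using assms(3) by (induction k) (simp_all add: m)
qed

text \<open>Repeated squaring of \<open>z\<close> ends at 1, and the last value before 1 must be the
  other square root of 1. Since \<open>z\<close> itself is not -1, at least one squaring happens
  first, so \<open>2 ^ k\<close> is even; this evenness is what keeps odd exponents odd in
  \<open>character_sum_odd_powers\<close>.\<close>

lemma power_two_power_eq_1_cases:
  fixes z :: complex
  assumes "z ^ 2 ^ n = 1" "z \<noteq> 1" "z \<noteq> - 1"
  shows "\<exists>k>0. z ^ 2 ^ k = - 1"
  using assms
proof (induction n arbitrary: z)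
  case (Suc n)
  have sq: "(z ^ 2) ^ 2 ^ k = z ^ 2 ^ Suc k" for k
    by (simp add: power_mult)
  show ?case
  proof (cases "z ^ 2 = - 1")
    case True
    then show ?thesis by (intro exI[of _ 1]) simp
  next
    case False
    moreover have "z ^ 2 \<noteq> 1"
      using Suc.prems by (simp add: power2_eq_1_iff)
    ultimately obtain k where "(z ^ 2) ^ 2 ^ k = - 1"
      using Suc.IH[of "z ^ 2"] Suc.prems(1) unfolding sq by blast
    then show ?thesis
      unfolding sq by blast
  qed
qed simp

text \<open>The condition \<open>z ^ 2 ^ (n - 1) = - 1\<close> encodes that \<open>z\<close> is a
  primitive \<open>2 ^ n\<close>-th root of unity. If \<open>m = 2 ^ k * u\<close> with
  \<open>u\<close> odd and \<open>k < n\<close>, raising \<open>z ^ m = 1\<close> to the power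
  \<open>2 ^ (n - 1 - k)\<close> would give \<open>(- 1) ^ u = 1\<close>.\<close>

lemma primitive_two_power_dvd:
  fixes z :: complex
  assumes "n > 0" "z ^ 2 ^ (n - 1) = - 1" "z ^ m = 1"
  shows "2 ^ n dvd m"
proof (cases "m = 0")
  case False
  then obtain k u where m: "m = 2 ^ k * u" "odd u"
    using prime_power_canonical[OF two_is_prime_nat, of m] by (auto simp: mult.commute)
  have "n \<le> k"
  proof (rule ccontr)
    assume "\<not> n \<le> k"
    then have "(2::nat) ^ (n - 1) = 2 ^ k * 2 ^ (n - 1 - k)"
      by (subst power_add[symmetric]) simp
    then have "2 ^ (n - 1) * u = m * 2 ^ (n - 1 - k)"
      by (simp only: m ac_simps)
    then have "(- 1) ^ u = (1::complex)"
      using assms(2,3) by (metis power_mult power_one)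
    with \<open>odd u\<close> show False by simp
  qed
  then show ?thesis
    by (simp add: m le_imp_power_dvd dvd_mult2)
qed simp

lemma primitive_two_power_eq_imp_cong:
  fixes z :: complex
  assumes "n > 0" "z ^ 2 ^ (n - 1) = - 1" "z ^ p = z ^ q"
  shows "[p = q] (mod 2 ^ n)"
proof -
  have z: "z \<noteq> 0"
    using assms(2) by (auto simp: power_0_left)
  have *: "[p = q] (mod 2 ^ n)" if "p \<le> q" "z ^ p = z ^ q" for p q
  proof -
    have "z ^ p * z ^ (q - p) = z ^ p"
      using that by (subst power_add[symmetric]) simp
    then have "z ^ (q - p) = 1"
      using z by simp
    from primitive_two_power_dvd[OF assms(1,2) this] show ?thesis
      using that(1) by (metis cong_altdef_nat cong_sym)
  qed
  show ?thesis
    using *[of p q] *[of q p] assms(3) by (metis cong_sym nat_le_linear)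
qed

text \<open>By counting: the powers of \<open>z\<close> with exponents below \<open>2 ^ n\<close>
  are distinct, and there are exactly \<open>2 ^ n\<close> roots of unity for them to fill.\<close>

lemma primitive_two_power_generates:
  fixes z y :: complex
  assumes "n > 0" "z ^ 2 ^ (n - 1) = - 1" "y ^ 2 ^ n = 1"
  shows "\<exists>k. y = z ^ k"
proof -
  let ?R = "{w::complex. w ^ 2 ^ n = 1}"
  have "2 ^ n = 2 ^ (n - 1) * (2::nat)"
    using assms(1) by (metis Suc_diff_1 power_Suc mult.commute)
  then have z: "z ^ 2 ^ n = 1"
    using assms(2) by (simp add: power_mult)
  have "inj_on (\<lambda>k. z ^ k) {..<2 ^ n}"
    using primitive_two_power_eq_imp_cong[OF assms(1,2)]
    by (auto intro!: inj_onI intro: cong_less_modulus_unique_nat)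
  then have "card ((\<lambda>k. z ^ k) ` {..<2 ^ n}) = 2 ^ n"
    by (simp add: card_image)
  moreover have "card ?R = 2 ^ n"
    by (rule card_roots_unity_eq) simp
  moreover have "(z ^ k) ^ 2 ^ n = 1" for k
    by (metis z power_mult mult.commute power_one)
  then have "(\<lambda>k. z ^ k) ` {..<2 ^ n} \<subseteq> ?R"
    by auto
  moreover have "finite ?R"
    by (rule finite_roots_unity) simp
  ultimately have "(\<lambda>k. z ^ k) ` {..<2 ^ n} = ?R"
    by (intro card_subset_eq) auto
  then show ?thesis
    using assms(3) by blast
qed

section \<open>Abelian groups of 2-power exponent: orbits, character sums and kernels\<close>

locale two_power_exponent_group = comm_group G for G (structure) +
  fixes n :: nat
  assumes n_pos: "n > 0"
    and exponent: "x \<in> carrier G \<Longrightarrow> x [^] (2 ^ n :: nat) = \<one>"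
begin

lemma pow_cong:
  assumes "x \<in> carrier G" "[k = l] (mod (2 ^ n :: nat))"
  shows "x [^] k = x [^] l"
proof -
  have "x [^] k = x [^] (k mod 2 ^ n)" for k :: nat
  proof -
    have "x [^] k = x [^] (2 ^ n * (k div 2 ^ n) + k mod 2 ^ n)"
      by simp
    also have "\<dots> = x [^] (k mod 2 ^ n)"
      using assms(1) by (subst nat_pow_mult[symmetric]) (simp_all add: exponent flip: nat_pow_pow)
    finally show ?thesis .
  qed
  then show ?thesis
    using assms(2) by (metis cong_def)
qed

lemma odd_powers_refl: "x \<in> carrier G \<Longrightarrow> x \<in> odd_powers G x"
  by (auto simp: odd_powers_def intro!: exI[of _ 1])

lemma odd_powers_closed: "x \<in> carrier G \<Longrightarrow> odd_powers G x \<subseteq> carrier G"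
  by (auto simp: odd_powers_def)

lemma odd_mod: "odd u \<Longrightarrow> odd (u mod 2 ^ n :: nat)"
  using n_pos by (simp add: dvd_mod_iff)

text \<open>Links odd powers to the exponents of the multiplier group, and makes the orbit visibly
  finite.\<close>

lemma odd_powers_eq_image:
  assumes "x \<in> carrier G"
  shows "odd_powers G x = (\<lambda>u. x [^] u) ` {u. odd u \<and> 1 \<le> u \<and> u \<le> (2 ^ n :: nat)}"
proof
  show "odd_powers G x \<subseteq> (\<lambda>u. x [^] u) ` {u. odd u \<and> 1 \<le> u \<and> u \<le> (2 ^ n :: nat)}"
  proof
    fix y
    assume "y \<in> odd_powers G x"
    then obtain u :: nat where u: "y = x [^] u" "odd u"
      by (auto simp: odd_powers_def)
    have "y = x [^] (u mod 2 ^ n)"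
      unfolding u(1) using assms by (intro pow_cong) auto
    moreover have "odd (u mod 2 ^ n)"
      using u(2) by (rule odd_mod)
    moreover from this have "1 \<le> u mod 2 ^ n"
      by (metis One_nat_def Suc_leI even_zero gr0I)
    moreover have "u mod 2 ^ n \<le> 2 ^ n"
      by (simp add: less_imp_le)
    ultimately show "y \<in> (\<lambda>u. x [^] u) ` {u. odd u \<and> 1 \<le> u \<and> u \<le> (2 ^ n :: nat)}"
      by blast
  qed
qed (auto simp: odd_powers_def)

lemma finite_odd_powers: "x \<in> carrier G \<Longrightarrow> finite (odd_powers G x)"
  by (simp add: odd_powers_eq_image)

lemma card_odd_powers_pos: "x \<in> carrier G \<Longrightarrow> card (odd_powers G x) > 0"
  using finite_odd_powers[of x] odd_powers_refl[of x] by (auto simp: card_gt_0_iff)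

lemma odd_powers_trans:
  assumes "x \<in> carrier G" "y \<in> odd_powers G x"
  shows "odd_powers G y \<subseteq> odd_powers G x"
proof
  fix z
  assume "z \<in> odd_powers G y"
  then obtain v u :: nat where "z = (x [^] u) [^] v" "odd v" "odd u"
    using assms(2) by (auto simp: odd_powers_def)
  then have "z = x [^] (u * v)" "odd (u * v)"
    using assms(1) by (simp_all add: nat_pow_pow)
  then show "z \<in> odd_powers G x"
    unfolding odd_powers_def by blast
qed

text \<open>An odd \<open>u\<close> is invertible mod \<open>2 ^ n\<close>, and raising
  \<open>y = x [^] u\<close> to the inverse exponent recovers \<open>x\<close>.\<close>

lemma odd_powers_sym:
  assumes "x \<in> carrier G" "y \<in> odd_powers G x"
  shows "x \<in> odd_powers G y"
proof -
  obtain u :: nat where u: "y = x [^] u" "odd u"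
    using assms(2) by (auto simp: odd_powers_def)
  then have "coprime u (2 ^ n)" by simp
  then obtain v where v: "[u * v = 1] (mod 2 ^ n)"
    using cong_solve_coprime_nat by (metis One_nat_def)
  \<comment> \<open>As \<open>n > 0\<close>, the congruence mod \<open>2 ^ n\<close> implies the one
    mod 2, so the inverse \<open>v\<close> is odd as well.\<close>
  have "even (u * v) \<longleftrightarrow> even (1::nat)"
    using v n_pos by (metis cong_dvd_iff cong_dvd_modulus_nat dvd_power)
  then have "odd v" by simp
  moreover have "x = y [^] v"
    using pow_cong[OF assms(1) v] assms(1) by (simp add: u nat_pow_pow)
  ultimately show ?thesis
    by (auto simp: odd_powers_def)
qed

lemma odd_powers_eq:
  assumes "x \<in> carrier G" "y \<in> odd_powers G x"
  shows "odd_powers G y = odd_powers G x"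
proof
  have "y \<in> carrier G"
    using assms odd_powers_closed by blast
  then show "odd_powers G x \<subseteq> odd_powers G y"
    using odd_powers_sym[OF assms] by (rule odd_powers_trans)
qed (rule odd_powers_trans[OF assms])

lemma ord_two_power:
  assumes "x \<in> carrier G"
  shows "\<exists>j\<le>n. ord x = 2 ^ j"
proof -
  have "ord x dvd 2 ^ n"
    using assms exponent by (simp add: pow_eq_id)
  then show ?thesis
    using divides_primepow_nat two_is_prime_nat by blast
qed

text \<open>The order of a power divides the order of the base; by \<open>odd_powers_sym\<close>
  this applies in both directions.\<close>

lemma ord_odd_powers:
  assumes "x \<in> carrier G" "y \<in> odd_powers G x"
  shows "ord y = ord x"
proof -
  have "ord b dvd ord a" if a: "a \<in> carrier G" and b: "b \<in> odd_powers G a" for a b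
  proof -
    obtain u :: nat where u: "b = a [^] u"
      using b by (auto simp: odd_powers_def)
    have "b [^] ord a = \<one>"
      using a by (simp add: u nat_pow_pow mult.commute[of u]) (simp flip: nat_pow_pow)
    then show ?thesis
      using a by (simp add: u flip: pow_eq_id)
  qed
  from this[OF assms] this[OF _ odd_powers_sym[OF assms]] show ?thesis
    using assms odd_powers_closed by (auto intro: dvd_antisym)
qed

lemma character_values_pm1:
  assumes "\<chi> \<in> hom G Cstar" "x \<in> carrier G" "y \<in> odd_powers G x"
  shows "\<chi> x = 1 \<Longrightarrow> \<chi> y = 1" "\<chi> x = - 1 \<Longrightarrow> \<chi> y = - 1"
  using assms by (auto simp: odd_powers_def hom_Cstar_nat_pow)

lemma character_sum_odd_powers:
  assumes \<chi>: "\<chi> \<in> hom G Cstar" and x: "x \<in> carrier G"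
  shows "(\<Sum>g\<in>odd_powers G x. \<chi> g) =
    (if \<chi> x = 1 then of_nat (card (odd_powers G x))
     else if \<chi> x = - 1 then - of_nat (card (odd_powers G x)) else 0)"
proof (cases "\<chi> x = 1 \<or> \<chi> x = - 1")
  case True
  then show ?thesis
    using character_values_pm1[OF assms] by auto
next
  case False
  note pow = hom_Cstar_nat_pow[OF monoid_axioms \<chi>]
  have "\<chi> \<one> = 1"
    using pow[of \<one> 0] by simp
  then have "\<chi> x ^ 2 ^ n = 1"
    using pow[OF x, of "2 ^ n"] x by (simp add: exponent)
  then obtain k where k: "k > 0" "\<chi> x ^ 2 ^ k = - 1"
    using False power_two_power_eq_1_cases by blast
  \<comment> \<open>Translation by \<open>z\<close> adds the even number \<open>2 ^ k\<close> to the
    exponent, so it maps the orbit into itself, and by finiteness onto itself.\<close>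
  define z where "z = x [^] (2 ^ k :: nat)"
  have z: "z \<in> carrier G" "\<chi> z = - 1"
    using assms k by (simp_all add: z_def hom_Cstar_nat_pow)
  let ?O = "odd_powers G x"
  have sub: "?O \<subseteq> carrier G"
    using x by (rule odd_powers_closed)
  have inj: "inj_on (\<lambda>y. y \<otimes> z) ?O"
    using sub z(1) by (meson inj_onI right_cancel subsetD)
  have "(\<lambda>y. y \<otimes> z) ` ?O \<subseteq> ?O"
  proof clarify
    fix y
    assume "y \<in> ?O"
    then obtain u :: nat where u: "y = x [^] u" "odd u"
      by (auto simp: odd_powers_def)
    then have "y \<otimes> z = x [^] (u + 2 ^ k)" "odd (u + 2 ^ k)"
      using x k(1) by (simp_all add: z_def nat_pow_mult)
    then show "y \<otimes> z \<in> ?O"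
      unfolding odd_powers_def by blast
  qed
  then have "(\<lambda>y. y \<otimes> z) ` ?O = ?O"
    using inj finite_odd_powers[OF x] by (metis endo_inj_surj)
  then have "(\<Sum>g\<in>?O. \<chi> g) = (\<Sum>g\<in>?O. \<chi> (g \<otimes> z))"
    using sum.reindex[OF inj, of \<chi>] by simp
  also have "\<dots> = (\<Sum>g\<in>?O. - \<chi> g)"
    using \<chi> z sub by (intro sum.cong) (auto simp: hom_def Cstar_def)
  \<comment> \<open>The sum equals its own negative, hence is 0.\<close>
  finally show ?thesis
    using False by (simp add: sum_negf)
qed

text \<open>The value \<open>\<chi> e1\<close> is a primitive \<open>2 ^ n\<close>-th root of unity,
  so \<open>inverse (\<chi> e2)\<close> is some power \<open>\<chi> e1 ^ a\<close>, which puts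
  \<open>w = e1 [^] a \<otimes> e2\<close> into the kernel. The exponent of \<open>e2\<close> in
  \<open>w [^] k\<close> is \<open>k\<close>, so \<open>indep\<close> gives \<open>w\<close> the
  order \<open>2 ^ n\<close>. A kernel element with exponents \<open>p\<close> and \<open>q\<close>
  turns out to be \<open>w [^] q\<close>.\<close>

lemma kernel_cyclic:
  assumes \<chi>: "\<chi> \<in> hom G Cstar"
    and e: "e1 \<in> carrier G" "e2 \<in> carrier G"
    and gen: "\<And>x. x \<in> carrier G \<Longrightarrow> \<exists>(p::nat) (q::nat). x = e1 [^] p \<otimes> e2 [^] q"
    and indep: "\<And>(p::nat) (q::nat). e1 [^] p \<otimes> e2 [^] q = \<one> \<Longrightarrow> 2 ^ n dvd q"
    and nontriv: "\<chi> e1 ^ 2 ^ (n - 1) \<noteq> 1"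
  shows "\<exists>w\<in>carrier G. \<chi> w = 1 \<and> ord w = 2 ^ n \<and>
    (\<forall>x\<in>carrier G. \<chi> x = 1 \<longrightarrow> (\<exists>k::nat. x = w [^] k))"
proof -
  note pow = hom_Cstar_nat_pow[OF monoid_axioms \<chi>]
  have mult: "\<chi> (a \<otimes> b) = \<chi> a * \<chi> b" "\<chi> a \<noteq> 0" if "a \<in> carrier G" "b \<in> carrier G" for a b
    using \<chi> that by (auto simp: hom_def Cstar_def)
  have one: "\<chi> \<one> = 1"
    using pow[of \<one> 0] by simp
  have root: "\<chi> x ^ 2 ^ n = 1" if "x \<in> carrier G" for x
    using pow[OF that, of "2 ^ n"] that one by (simp add: exponent)
  have "(\<chi> e1 ^ 2 ^ (n - 1)) ^ 2 = 1"
    using root[OF e(1)] n_pos by (simp flip: power_mult power_Suc2)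
  then have prim: "\<chi> e1 ^ 2 ^ (n - 1) = - 1"
    using nontriv by (simp add: power2_eq_1_iff)
  have "inverse (\<chi> e2) ^ 2 ^ n = 1"
    using root[OF e(2)] by (simp add: power_inverse)
  then obtain a where a: "inverse (\<chi> e2) = \<chi> e1 ^ a"
    using primitive_two_power_generates[OF n_pos prim] by blast
  define w where "w = e1 [^] a \<otimes> e2"
  have w: "w \<in> carrier G"
    using e by (simp add: w_def)
  have \<chi>w: "\<chi> w = 1"
    using e mult(2)[OF e(2) e(2)] by (simp add: w_def mult(1) pow flip: a)
  have w_pow: "w [^] k = e1 [^] (a * k) \<otimes> e2 [^] k" for k :: nat
    using e by (simp add: w_def nat_pow_distrib nat_pow_pow)
  have "2 ^ n dvd ord w"
    using indep[of "a * ord w" "ord w"] w by (simp flip: w_pow)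
  moreover have "ord w dvd 2 ^ n"
    using w exponent by (simp add: pow_eq_id)
  ultimately have "ord w = 2 ^ n"
    by (rule dvd_antisym[symmetric])
  moreover have "\<exists>k::nat. x = w [^] k" if x: "x \<in> carrier G" "\<chi> x = 1" for x
  proof -
    obtain p q :: nat where pq: "x = e1 [^] p \<otimes> e2 [^] q"
      using gen x(1) by blast
    \<comment> \<open>Both sides are 1: they are the values of \<open>\<chi>\<close> at
      \<open>x\<close> and at \<open>w [^] q\<close>.\<close>
    have "\<chi> e1 ^ p * \<chi> e2 ^ q = \<chi> e1 ^ (a * q) * \<chi> e2 ^ q"
      using x(2) pow[OF w, of q] e by (simp add: pq w_pow mult(1) pow \<chi>w)
    then have "\<chi> e1 ^ p = \<chi> e1 ^ (a * q)"
      using mult(2)[OF e(2) e(2)] by simp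
    then have "e1 [^] p = e1 [^] (a * q)"
      using primitive_two_power_eq_imp_cong[OF n_pos prim] pow_cong e(1) by blast
    then show ?thesis
      by (auto simp: pq w_pow)
  qed
  ultimately show ?thesis
    using w \<chi>w by blast
qed

end

section \<open>The group \<open>GG n\<close> and its characters of order
  \<open>2 ^ n\<close>\<close>

lemma GG_carrier: "carrier (GG n) = carrier (cyc (2 ^ n)) \<times> carrier (cyc (2 ^ n))"
  by (simp add: GG_def)

lemma GG_mult: "(a, b) \<otimes>\<^bsub>GG n\<^esub> (c, d) = (frac (a + c), frac (b + d))"
  by (simp add: GG_def cyc_def)

lemma GG_one: "\<one>\<^bsub>GG n\<^esub> = (0, 0)"
  by (simp add: GG_def cyc_def)

lemma GG_nat_pow:
  "(a, b) [^]\<^bsub>GG n\<^esub> (k::nat) = (frac (of_nat k * a), frac (of_nat k * b))"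
proof (induction k)
  case 0
  then show ?case by (simp add: nat_pow_def GG_one)
next
  case (Suc k)
  have "frac (frac (of_nat k * c) + c) = frac (of_nat (Suc k) * c)" for c :: rat
    by (simp add: frac_def algebra_simps add_diff_eq)
  with Suc show ?case
    by (simp add: nat_pow_def GG_mult)
qed

lemma GG_two_power_exponent_group:
  assumes "n > 0"
  shows "two_power_exponent_group (GG n) n"
proof -
  interpret group "GG n" by (rule GG_group)
  show ?thesis
  proof unfold_locales
    fix x y
    show "x \<otimes>\<^bsub>GG n\<^esub> y = y \<otimes>\<^bsub>GG n\<^esub> x"
      by (cases x; cases y) (simp add: GG_mult add.commute)
  next
    fix x
    assume x: "x \<in> carrier (GG n)"
    obtain a b where "x = (a, b)" by force
    with x show "x [^]\<^bsub>GG n\<^esub> (2 ^ n :: nat) = \<one>\<^bsub>GG n\<^esub>"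
      by (simp add: GG_carrier GG_nat_pow GG_one cyc_carrier_iff mult.commute)
  qed (rule assms)
qed

lemma dual_group_nat_pow:
  assumes "group G" "\<chi> \<in> carrier (dual_group G)"
  shows "\<chi> [^]\<^bsub>dual_group G\<^esub> (k::nat) = (\<lambda>g\<in>carrier G. \<chi> g ^ k)"
proof (induction k)
  case 0
  then show ?case by (simp add: nat_pow_def dual_group_def)
next
  case (Suc k)
  then show ?case
    by (auto simp: nat_pow_def dual_group_def fun_eq_iff)
qed

text \<open>Applies \<open>kernel_cyclic\<close> to the standard generators \<open>(t, 0)\<close>
  and \<open>(0, t)\<close>, with the one of them first on which \<open>\<chi>\<close> takes a
  primitive \<open>2 ^ n\<close>-th root of unity as value.\<close>

lemma GG_kernel_cyclic:
  assumes "n > 0" "\<chi> \<in> carrier (dual_group (GG n))"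
    and ord: "group.ord (dual_group (GG n)) \<chi> = 2 ^ n"
  shows "\<exists>w\<in>carrier (GG n). \<chi> w = 1 \<and> group.ord (GG n) w = 2 ^ n \<and>
    (\<forall>x\<in>carrier (GG n). \<chi> x = 1 \<longrightarrow> (\<exists>k::nat. x = w [^]\<^bsub>GG n\<^esub> k))"
proof -
  interpret two_power_exponent_group "GG n" n
    using assms(1) by (rule GG_two_power_exponent_group)
  interpret D: comm_group "dual_group (GG n)"
    by (rule dual_group_comm_group[OF GG_group])
  have \<chi>: "\<chi> \<in> hom (GG n) Cstar"
    using assms(2) by (simp add: dual_group_def)
  define t where "t = (1 / 2 ^ n :: rat)"
  have t: "t \<in> carrier (cyc (2 ^ n))" "0 \<in> carrier (cyc (2 ^ n))"
    using assms(1) by (simp_all add: cyc_carrier_iff t_def)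
  then have e: "(t, 0) \<in> carrier (GG n)" "(0, t) \<in> carrier (GG n)"
    by (simp_all add: GG_carrier)
  have pows: "(t, 0) [^]\<^bsub>GG n\<^esub> p \<otimes>\<^bsub>GG n\<^esub> (0, t) [^]\<^bsub>GG n\<^esub> q =
      (frac (of_nat p * t), frac (of_nat q * t))" for p q :: nat
    by (simp add: GG_nat_pow GG_mult)
  have gen: "\<exists>(p::nat) (q::nat). x = (t, 0) [^]\<^bsub>GG n\<^esub> p \<otimes>\<^bsub>GG n\<^esub> (0, t) [^]\<^bsub>GG n\<^esub> q"
    if x: "x \<in> carrier (GG n)" for x
  proof -
    obtain p q where "x = (of_nat p / of_nat (2 ^ n), of_nat q / of_nat (2 ^ n))"
        "p < 2 ^ n" "q < 2 ^ n"
      using x by (auto simp: GG_carrier cyc_def)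
    then have "x = (frac (of_nat p * t), frac (of_nat q * t))"
      by (simp add: t_def frac_eq)
    then show ?thesis
      unfolding pows by blast
  qed
  have dvd: "2 ^ n dvd k" if k: "frac (of_nat k * t) = 0" for k :: nat
  proof -
    have "of_nat k * t \<in> \<int>"
      using k by (simp add: frac_eq_0_iff)
    then obtain i where "of_nat k * t = of_int i"
      by (auto elim: Ints_cases)
    then have "(of_int (int k) :: rat) = of_int (2 ^ n * i)"
      by (simp add: t_def field_simps)
    then have "int k = 2 ^ n * i"
      by (simp only: of_int_eq_iff)
    then have "int (2 ^ n) dvd int k"
      by simp
    then show ?thesis
      by (simp only: int_dvd_int_iff)
  qed
  \<comment> \<open>Otherwise the power \<open>2 ^ (n - 1)\<close> of \<open>\<chi>\<close> would be
    trivial on both generators, hence everywhere, against the order of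
    \<open>\<chi>\<close>.\<close>
  have "\<chi> (t, 0) ^ 2 ^ (n - 1) \<noteq> 1 \<or> \<chi> (0, t) ^ 2 ^ (n - 1) \<noteq> 1"
  proof (rule ccontr)
    assume *: "\<not> ?thesis"
    have "\<chi> x ^ 2 ^ (n - 1) = 1" if x: "x \<in> carrier (GG n)" for x
    proof -
      obtain p q :: nat where "x = (t, 0) [^]\<^bsub>GG n\<^esub> p \<otimes>\<^bsub>GG n\<^esub> (0, t) [^]\<^bsub>GG n\<^esub> q"
        using gen[OF x] by blast
      then have "\<chi> x = \<chi> (t, 0) ^ p * \<chi> (0, t) ^ q"
        using \<chi> e hom_Cstar_nat_pow[OF monoid_axioms \<chi>]
        by (simp add: hom_mult[OF \<chi>]) (simp add: Cstar_def)
      then have "\<chi> x ^ 2 ^ (n - 1) =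
          (\<chi> (t, 0) ^ 2 ^ (n - 1)) ^ p * (\<chi> (0, t) ^ 2 ^ (n - 1)) ^ q"
        by (simp add: power_mult_distrib mult.commute flip: power_mult)
      then show ?thesis
        using * by simp
    qed
    then have "\<chi> [^]\<^bsub>dual_group (GG n)\<^esub> (2 ^ (n - 1) :: nat) = \<one>\<^bsub>dual_group (GG n)\<^esub>"
      unfolding dual_group_nat_pow[OF GG_group assms(2)] by (auto simp: dual_group_def fun_eq_iff)
    then have "(2::nat) ^ n dvd 2 ^ (n - 1)"
      using D.pow_eq_id[OF assms(2)] ord by simp
    then show False
      using assms(1) by (simp add: power_dvd_imp_le dvd_power_iff_le)
  qed
  then show ?thesis
  proof
    assume "\<chi> (t, 0) ^ 2 ^ (n - 1) \<noteq> 1"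
    then show ?thesis
      using gen by (intro kernel_cyclic[OF \<chi> e]) (auto simp: pows GG_one intro: dvd)
  next
    \<comment> \<open>Here the generators exchange roles; commutativity carries \<open>gen\<close>
      and \<open>pows\<close> over to the swapped products.\<close>
    assume nontriv: "\<chi> (0, t) ^ 2 ^ (n - 1) \<noteq> 1"
    have comm: "(0, t) [^]\<^bsub>GG n\<^esub> p \<otimes>\<^bsub>GG n\<^esub> (t, 0) [^]\<^bsub>GG n\<^esub> q =
        (t, 0) [^]\<^bsub>GG n\<^esub> q \<otimes>\<^bsub>GG n\<^esub> (0, t) [^]\<^bsub>GG n\<^esub> p" for p q :: nat
      using e by (intro m_comm) auto
    have "\<exists>(p::nat) (q::nat). x = (0, t) [^]\<^bsub>GG n\<^esub> p \<otimes>\<^bsub>GG n\<^esub> (t, 0) [^]\<^bsub>GG n\<^esub> q"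
      if "x \<in> carrier (GG n)" for x
      unfolding comm using gen[OF that] by blast
    moreover have "2 ^ n dvd q"
      if "(0, t) [^]\<^bsub>GG n\<^esub> p \<otimes>\<^bsub>GG n\<^esub> (t, 0) [^]\<^bsub>GG n\<^esub> q = \<one>\<^bsub>GG n\<^esub>" for p q :: nat
      using that unfolding comm pows GG_one by (intro dvd) simp
    ultimately show ?thesis
      using nontriv by (rule kernel_cyclic[OF \<chi> e(2,1)])
  qed
qed

section \<open>Nodes, levels and parents in terms of odd powers\<close>

lemma nodes_eq_odd_powers:
  assumes "n > 0"
  shows "nodes n = odd_powers (GG n) ` carrier (GG n)"
proof -
  interpret two_power_exponent_group "GG n" n
    using assms by (rule GG_two_power_exponent_group)
  have "orbit (mult_group n) (mult_action n) x = odd_powers (GG n) x" if "x \<in> carrier (GG n)" for x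
    unfolding odd_powers_eq_image[OF that] orbit_def
    using that by (auto simp: mult_group_def mult_action_def)
  then have "orbit (mult_group n) (mult_action n) ` carrier (GG n) = odd_powers (GG n) ` carrier (GG n)"
    by (intro image_cong) auto
  then show ?thesis
    by (simp only: nodes_def orbits_def Setcompr_eq_image)
qed

text \<open>The order is constant on an orbit, so one representative decides the level.\<close>

lemma level_nodes_iff:
  assumes "n > 0" "x \<in> carrier (GG n)"
  shows "odd_powers (GG n) x \<in> level_nodes n i \<longleftrightarrow> group.ord (GG n) x = 2 ^ i"
proof -
  interpret two_power_exponent_group "GG n" n
    using assms(1) by (rule GG_two_power_exponent_group)
  show ?thesis
    using assms(2) odd_powers_refl[OF assms(2)] ord_odd_powers[OF assms(2)]
    unfolding level_nodes_def nodes_eq_odd_powers[OF assms(1)] by fastforce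
qed

text \<open>Squaring commutes with taking odd powers, so the squares of one orbit stay in one
  orbit.\<close>

lemma parent_rel_square:
  assumes "n > 0" "x \<in> carrier (GG n)" "x \<noteq> \<one>\<^bsub>GG n\<^esub>"
  shows "(odd_powers (GG n) x, odd_powers (GG n) (x [^]\<^bsub>GG n\<^esub> (2::nat))) \<in> parent_rel n"
proof -
  interpret two_power_exponent_group "GG n" n
    using assms(1) by (rule GG_two_power_exponent_group)
  obtain j where j: "ord x = 2 ^ j"
    using ord_two_power assms(2) by blast
  \<comment> \<open>\<open>parent_rel\<close> gives parents only to nodes at a level of the form
    \<open>Suc i\<close>, which excludes the root.\<close>
  have "j \<noteq> 0"
    using j assms(2,3) ord_eq_1 by (metis power_0)
  then have "odd_powers (GG n) x \<in> level_nodes n (Suc (j - 1))"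
    using j assms by (simp add: level_nodes_iff)
  moreover have "y \<otimes>\<^bsub>GG n\<^esub> y \<in> odd_powers (GG n) (x [^]\<^bsub>GG n\<^esub> (2::nat))"
    if y: "y \<in> odd_powers (GG n) x" for y
  proof -
    obtain u :: nat where u: "y = x [^]\<^bsub>GG n\<^esub> u" "odd u"
      using y by (auto simp: odd_powers_def)
    have "y \<otimes>\<^bsub>GG n\<^esub> y = (x [^]\<^bsub>GG n\<^esub> (2::nat)) [^]\<^bsub>GG n\<^esub> u"
      using assms(2) by (simp add: u nat_pow_mult nat_pow_pow mult_2)
    with u(2) show ?thesis
      by (auto simp: odd_powers_def)
  qed
  moreover have "odd_powers (GG n) (x [^]\<^bsub>GG n\<^esub> (2::nat)) \<in> nodes n"
    using assms by (simp add: nodes_eq_odd_powers)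
  ultimately show ?thesis
    by (auto simp: parent_rel_def)
qed

lemma odd_powers_one:
  assumes "n > 0"
  shows "odd_powers (GG n) \<one>\<^bsub>GG n\<^esub> = root_node"
proof -
  interpret two_power_exponent_group "GG n" n
    using assms by (rule GG_two_power_exponent_group)
  have "odd_powers (GG n) \<one>\<^bsub>GG n\<^esub> = {\<one>\<^bsub>GG n\<^esub>}"
    using odd_powers_refl[OF one_closed] by (auto simp only: odd_powers_def nat_pow_one)
  then show ?thesis
    by (simp only: root_node_def GG_one)
qed

text \<open>Each squaring climbs one edge until the identity is reached; from there on squaring
  stays at the root, so \<open>i\<close> may exceed the level of the node.\<close>

lemma ancestor_two_power:
  assumes "n > 0" "x \<in> carrier (GG n)"
  shows "(odd_powers (GG n) x, odd_powers (GG n) (x [^]\<^bsub>GG n\<^esub> (2 ^ i :: nat))) \<in> (parent_rel n)\<^sup>*"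
proof -
  interpret two_power_exponent_group "GG n" n
    using assms(1) by (rule GG_two_power_exponent_group)
  show ?thesis
  proof (induction i)
    case 0
    then show ?case using assms by simp
  next
    case (Suc i)
    let ?y = "x [^]\<^bsub>GG n\<^esub> (2 ^ i :: nat)"
    have y: "?y \<in> carrier (GG n)" and sq: "x [^]\<^bsub>GG n\<^esub> (2 ^ Suc i :: nat) = ?y [^]\<^bsub>GG n\<^esub> (2::nat)"
      using assms(2) by (simp_all add: nat_pow_pow mult.commute)
    show ?case
    proof (cases "?y = \<one>\<^bsub>GG n\<^esub>")
      case True
      then show ?thesis
        using Suc unfolding sq by simp
    next
      case False
      then show ?thesis
        using Suc parent_rel_square[OF assms(1) y] unfolding sq by (blast intro: rtrancl_into_rtrancl)
    qed
  qed
qed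

lemma node_to_root:
  assumes "n > 0" "x \<in> carrier (GG n)"
  shows "(odd_powers (GG n) x, root_node) \<in> (parent_rel n)\<^sup>*"
proof -
  interpret two_power_exponent_group "GG n" n
    using assms(1) by (rule GG_two_power_exponent_group)
  show ?thesis
    using ancestor_two_power[OF assms, of n] assms
    by (simp add: exponent odd_powers_one)
qed

section \<open>The sets \<open>P_plus\<close> and \<open>P_minus\<close> as fibres of the
  character\<close>

lemma character_of_child:
  assumes "n > 0" "\<chi> \<in> hom (GG n) Cstar" "(M, Y) \<in> parent_rel n" "\<forall>y\<in>Y. \<chi> y = 1" "x \<in> M"
  shows "x \<in> carrier (GG n) \<and> \<chi> x ^ 2 = 1"
proof -
  interpret two_power_exponent_group "GG n" n
    using assms(1) by (rule GG_two_power_exponent_group)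
  have x: "x \<in> carrier (GG n)"
    using assms(1,3,5) odd_powers_closed
    by (auto simp: parent_rel_def level_nodes_def nodes_eq_odd_powers)
  moreover have "x \<otimes>\<^bsub>GG n\<^esub> x \<in> Y"
    using assms(3,5) by (auto simp: parent_rel_def)
  then have "\<chi> (x \<otimes>\<^bsub>GG n\<^esub> x) = 1"
    using assms(4) by blast
  then have "\<chi> x ^ 2 = 1"
    using hom_mult[OF assms(2) x x] by (simp add: Cstar_def power2_eq_square)
  ultimately show ?thesis by blast
qed

text \<open>The value 1 passes from a node to its parent, because the parent is the orbit of a
  square. Conversely, a kernel element \<open>w [^] k\<close> with \<open>k = 2 ^ i * u\<close> and
  \<open>u\<close> odd lies in the orbit of \<open>w [^] 2 ^ i\<close>, an ancestor of the orbit of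
  \<open>w\<close>.\<close>

lemma P_plus_odd_powers_iff:
  assumes n: "n > 0" and \<chi>: "\<chi> \<in> hom (GG n) Cstar"
    and w: "w \<in> carrier (GG n)" "\<chi> w = 1"
    and gen: "\<forall>x\<in>carrier (GG n). \<chi> x = 1 \<longrightarrow> (\<exists>k::nat. x = w [^]\<^bsub>GG n\<^esub> k)"
    and x: "x \<in> carrier (GG n)"
  shows "odd_powers (GG n) x \<in> P_plus n (odd_powers (GG n) w) \<longleftrightarrow> \<chi> x = 1"
proof -
  interpret two_power_exponent_group "GG n" n
    using n by (rule GG_two_power_exponent_group)
  let ?O = "odd_powers (GG n)"
  have "\<chi> x = 1" if "?O x \<in> P_plus n (?O w)"
  proof -
    have "\<forall>y\<in>Y. \<chi> y = 1" if "(?O w, Y) \<in> (parent_rel n)\<^sup>*" for Y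
      using that
    proof induction
      case base
      then show ?case
        using character_values_pm1[OF \<chi> w(1)] w(2) by blast
    next
      case (step Y Z)
      obtain z where z: "Z = ?O z" "z \<in> carrier (GG n)"
        using step(2) n by (auto simp: parent_rel_def nodes_eq_odd_powers)
      obtain y where y: "Y = ?O y" "y \<in> carrier (GG n)"
        using step(2) n by (auto simp: parent_rel_def level_nodes_def nodes_eq_odd_powers)
      have yY: "y \<in> Y"
        using y odd_powers_refl by blast
      then have "y \<otimes>\<^bsub>GG n\<^esub> y \<in> ?O z"
        using step(2) z by (auto simp: parent_rel_def)
      then have "?O (y \<otimes>\<^bsub>GG n\<^esub> y) = Z"
        using odd_powers_eq z by blast
      moreover have "\<chi> (y \<otimes>\<^bsub>GG n\<^esub> y) = 1"
        using step(3) yY hom_mult[OF \<chi> y(2) y(2)] by (simp add: Cstar_def)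
      ultimately show ?case
        using character_values_pm1(1)[OF \<chi>, of "y \<otimes>\<^bsub>GG n\<^esub> y"] y(2) by blast
    qed
    then show ?thesis
      using that odd_powers_refl[OF x] by (auto simp: P_plus_def)
  qed
  moreover have "?O x \<in> P_plus n (?O w)" if \<chi>x: "\<chi> x = 1"
  proof -
    obtain k :: nat where k: "x = w [^]\<^bsub>GG n\<^esub> k"
      using gen x \<chi>x by blast
    have "(?O w, ?O x) \<in> (parent_rel n)\<^sup>*"
    \<comment> \<open>Zero has no odd part; it yields the identity, that is, the root.\<close>
    proof (cases "k = 0")
      case True
      then show ?thesis
        using node_to_root[OF n w(1)] n by (simp add: k odd_powers_one)
    next
      case False
      then obtain i u where u: "k = 2 ^ i * u" "odd u"
        using prime_power_canonical[OF two_is_prime_nat, of k] by (auto simp: mult.commute)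
      then have "x = (w [^]\<^bsub>GG n\<^esub> (2 ^ i :: nat)) [^]\<^bsub>GG n\<^esub> u"
        using w(1) by (simp add: k nat_pow_pow)
      then have "x \<in> ?O (w [^]\<^bsub>GG n\<^esub> (2 ^ i :: nat))"
        using u(2) by (auto simp: odd_powers_def)
      then have "?O x = ?O (w [^]\<^bsub>GG n\<^esub> (2 ^ i :: nat))"
        using w(1) by (intro odd_powers_eq) auto
      then show ?thesis
        using ancestor_two_power[OF n w(1)] by simp
    qed
    then show ?thesis
      using node_to_root[OF n x] by (simp add: P_plus_def)
  qed
  ultimately show ?thesis by blast
qed

text \<open>A child of a node in the kernel satisfies \<open>\<chi> x ^ 2 = 1\<close>, and off the
  path the value 1 is excluded by \<open>P_plus_odd_powers_iff\<close>. Conversely,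
  \<open>\<chi> x = - 1\<close> places the square of \<open>x\<close> in the kernel, so the parent
  is on the path.\<close>

lemma P_minus_odd_powers_iff:
  assumes n: "n > 0" and \<chi>: "\<chi> \<in> hom (GG n) Cstar"
    and w: "w \<in> carrier (GG n)" "\<chi> w = 1"
    and gen: "\<forall>x\<in>carrier (GG n). \<chi> x = 1 \<longrightarrow> (\<exists>k::nat. x = w [^]\<^bsub>GG n\<^esub> k)"
    and x: "x \<in> carrier (GG n)"
  shows "odd_powers (GG n) x \<in> P_minus n (odd_powers (GG n) w) \<longleftrightarrow> \<chi> x = - 1"
proof -
  interpret two_power_exponent_group "GG n" n
    using n by (rule GG_two_power_exponent_group)
  let ?O = "odd_powers (GG n)"
  note plus = P_plus_odd_powers_iff[OF n \<chi> w gen]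
  show ?thesis
  proof
    assume "?O x \<in> P_minus n (?O w)"
    then obtain Y where Y: "Y \<in> P_plus n (?O w)" "(?O x, Y) \<in> parent_rel n"
      and "\<chi> x \<noteq> 1"
      using plus[OF x] by (auto simp: P_minus_def children_def)
    obtain y where y: "Y = ?O y" "y \<in> carrier (GG n)"
      using Y(2) n by (auto simp: parent_rel_def nodes_eq_odd_powers)
    then have "\<forall>y\<in>Y. \<chi> y = 1"
      using Y(1) plus character_values_pm1(1)[OF \<chi>] by blast
    then have "\<chi> x ^ 2 = 1"
      using character_of_child[OF n \<chi> Y(2)] odd_powers_refl[OF x] by blast
    with \<open>\<chi> x \<noteq> 1\<close> show "\<chi> x = - 1"
      by (simp add: power2_eq_1_iff)
  next
    assume m1: "\<chi> x = - 1"
    then have "x \<noteq> \<one>\<^bsub>GG n\<^esub>"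
      using hom_Cstar_nat_pow[OF monoid_axioms \<chi> one_closed, of 0] by auto
    then have "?O x \<in> children n (?O (x [^]\<^bsub>GG n\<^esub> (2::nat)))"
      using parent_rel_square[OF n x] by (simp add: children_def)
    moreover have "?O (x [^]\<^bsub>GG n\<^esub> (2::nat)) \<in> P_plus n (?O w)"
      using x m1 by (simp add: plus hom_Cstar_nat_pow[OF monoid_axioms \<chi>])
    moreover have "?O x \<notin> P_plus n (?O w)"
      using m1 by (simp add: plus[OF x])
    ultimately show "?O x \<in> P_minus n (?O w)"
      by (auto simp: P_minus_def)
  qed
qed

theorem theorem2p4:
  fixes n :: nat and \<chi> :: "rat \<times> rat \<Rightarrow> complex"
  assumes "n \<ge> 2"
    and "\<chi> \<in> carrier (dual_group (GG n))"
    and "group.ord (dual_group (GG n)) \<chi> = 2 ^ n"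
  shows "\<exists>!N. N \<in> level_nodes n n \<and> (\<forall>M\<in>nodes n. (\<Sum>g\<in>M. \<chi> g) = chi_node n N M)"
proof -
  have n: "n > 0" using assms(1) by simp
  interpret two_power_exponent_group "GG n" n
    using n by (rule GG_two_power_exponent_group)
  let ?O = "odd_powers (GG n)"
  have \<chi>: "\<chi> \<in> hom (GG n) Cstar"
    using assms(2) by (simp add: dual_group_def)
  obtain w where w: "w \<in> carrier (GG n)" "\<chi> w = 1" and ord_w: "ord w = 2 ^ n"
    and gen: "\<forall>x\<in>carrier (GG n). \<chi> x = 1 \<longrightarrow> (\<exists>k::nat. x = w [^]\<^bsub>GG n\<^esub> k)"
    using GG_kernel_cyclic[OF n assms(2,3)] by blast
  show ?thesis
  proof (rule ex1I[of _ "?O w"], intro conjI ballI)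
    show "?O w \<in> level_nodes n n"
      using n w ord_w by (simp add: level_nodes_iff)
  next
    fix M
    assume "M \<in> nodes n"
    then obtain x where x: "M = ?O x" "x \<in> carrier (GG n)"
      using n by (auto simp: nodes_eq_odd_powers)
    then show "(\<Sum>g\<in>M. \<chi> g) = chi_node n (?O w) M"
      by (simp add: chi_node_def character_sum_odd_powers[OF \<chi>]
          P_plus_odd_powers_iff[OF n \<chi> w gen] P_minus_odd_powers_iff[OF n \<chi> w gen])
  next
    fix N
    assume N: "N \<in> level_nodes n n \<and> (\<forall>M\<in>nodes n. (\<Sum>g\<in>M. \<chi> g) = chi_node n N M)"
    then obtain x where x: "N = ?O x" "x \<in> carrier (GG n)"
      using n by (auto simp: level_nodes_def nodes_eq_odd_powers)
    have ord_x: "ord x = 2 ^ n"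
      using N x n by (simp add: level_nodes_iff)
    \<comment> \<open>Uniqueness: evaluating the formula at \<open>M = N\<close> gives the sum
      \<open>card N\<close>, which is positive and therefore rules out the values
      \<open>- card N\<close> and 0. So \<open>\<chi>\<close> is 1 on \<open>N\<close>.\<close>
    have "N \<in> P_plus n N"
      using node_to_root[OF n x(2)] by (simp add: P_plus_def x(1))
    moreover have "(\<Sum>g\<in>N. \<chi> g) = chi_node n N N"
      using N by (auto simp: level_nodes_def)
    ultimately have "(\<Sum>g\<in>?O x. \<chi> g) = of_nat (card (?O x))"
      by (simp add: chi_node_def x(1))
    then have "\<chi> x = 1"
      using card_odd_powers_pos[OF x(2)]
      by (auto simp: character_sum_odd_powers[OF \<chi> x(2)] split: if_splits)
    then obtain k :: nat where k: "x = w [^]\<^bsub>GG n\<^esub> k"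
      using gen x(2) by blast
    \<comment> \<open>An even exponent would make \<open>x\<close> vanish under the power
      \<open>2 ^ (n - 1)\<close>, while \<open>N\<close> consists of elements of order
      \<open>2 ^ n\<close>.\<close>
    have "odd k"
    proof
      assume "even k"
      then obtain l where l: "k = 2 * l" by blast
      have "k * 2 ^ (n - 1) = 2 ^ n * l"
        using n by (cases n) (simp_all add: l)
      then have "x [^]\<^bsub>GG n\<^esub> (2 ^ (n - 1) :: nat) = \<one>\<^bsub>GG n\<^esub>"
        using w(1) by (simp add: k nat_pow_pow) (simp add: exponent flip: nat_pow_pow)
      then have "(2::nat) ^ n dvd 2 ^ (n - 1)"
        using pow_eq_id[OF x(2)] ord_x by simp
      then show False
        using n by (simp add: dvd_power_iff_le)
    qed
    then have "x \<in> ?O w"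
      by (auto simp: k odd_powers_def)
    then show "N = ?O w"
      using odd_powers_eq[OF w(1)] x(1) by blast
  qed
qed

end
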